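(* Let $k\ge 1$ and let $\mathcal{E}=\{(\mu_i,\tau_i): i\in[k]\}$ be a (multi)set of concentrated differential privacy parameters. Then for every $\delta\in(0,1]$, $\mathcal{E}$ is $(\varepsilon_g,\delta)$-differentially private under set-wise adaptive composition, where $$\varepsilon_g=\sum_{i\in[k]}\mu_i+\sqrt{2\sum_{i\in[k]}\tau_i^2\,\ln(1/\delta)}.$$
   Context: Datasets come from a data universe $\mathcal{X}$ with a symmetric neighboring relation $x\sim x'$ (one user's data added or removed). For random variables $Y,Z$ with the same support, the privacy loss random variable is $L_{Y\|Z}=\ln\frac{\Pr[Y=y]}{\Pr[Z=y]}$ with $y\sim Y$ (probability masses or densities). A randomized algorithm $M$ is $(\mu,\tau)$-concentrated differentially private (CDP) if for all neighbors $x,x'$: $\mathbb{E}[L_{M(x)\|M(x')}]\le\mu$ and for all $\lambda\in\mathbb{R}$, $\mathbb{E}[\exp(\lambda(L_{M(x)\|M(x')}-\mathbb{E}[L_{M(x)\|M(x')}]))]\le e^{\lambda^2\tau^2/2}$. The $\mathcal{E}$-set-wise adaptive composition experiment $b$, for $b\in\{0,1\}$ (hidden from the analyst): there are $k$ rounds. At round $i$, as a deterministic function of the outcomes of previous rounds, the analyst selects a pair $(\mu,\tau)$ among the parameters still remaining in $\mathcal{E}$ (which is then removed from $\mathcal{E}$, i.e. selection is without replacement), a $(\mu,\tau)$-CDP mechanism $M_i$, and a pair of neighboring datasets $x_i^{(0)},x_i^{(1)}$; the analyst then sees an outcome of $M_i(x_i^{(b)})$, generated with fresh randomness. The experiment ends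 when $\mathcal{E}=\emptyset$. The view $V^{(b)}$ is the collection of all outcomes seen by the analyst in experiment $b$. $\mathcal{E}$ is $(\varepsilon_g,\delta)$-differentially private under set-wise adaptive composition if, for every analyst, every $b\in\{0,1\}$ and every outcome set $S$, $\Pr[V^{(b)}\in S]\le e^{\varepsilon_g}\Pr[V^{(1-b)}\in S]+\delta$. *)

theory Defs
  imports "HOL-Probability.Probability" "HOL-Library.Multiset"
begin

text \<open>
  The ratio of probability masses or densities of \<open>P\<close> and \<open>Q\<close> is the Radon-Nikodym derivative
  of \<open>P\<close> with respect to \<open>Q\<close>; note the argument order of \<open>RN_deriv\<close>. The privacy loss random
  variable is this function, evaluated at a point drawn from \<open>P\<close>.
\<close>
definition privacy_loss :: "'y measure \<Rightarrow> 'y measure \<Rightarrow> 'y \<Rightarrow> real" where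
  "privacy_loss P Q y = ln (enn2real (RN_deriv Q P y))"

text \<open>
  Having the same support means having the same null sets: for distributions with masses or
  densities with respect to a common measure, it says that these are positive at the same points
  up to a null set.
\<close>
definition same_support :: "'y measure \<Rightarrow> 'y measure \<Rightarrow> bool" where
  "same_support P Q \<longleftrightarrow> absolutely_continuous P Q \<and> absolutely_continuous Q P"

text \<open>
  The integrability conditions state that the expectations exist; without them the
  Bochner integral would be the default value \<open>0\<close>.
\<close>
definition CDP ::
    "('x \<Rightarrow> 'x \<Rightarrow> bool) \<Rightarrow> 'y measure \<Rightarrow> real \<Rightarrow> real \<Rightarrow> ('x \<Rightarrow> 'y measure) \<Rightarrow> bool" where
  "CDP nbr Y \<mu> \<tau> M \<longleftrightarrow>
     (\<forall>x. M x \<in> space (prob_algebra Y)) \<and>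
     (\<forall>x x'. nbr x x' \<longrightarrow>
        (let L = privacy_loss (M x) (M x'); m = (\<integral>y. L y \<partial>M x) in
           same_support (M x) (M x') \<and>
           integrable (M x) L \<and> m \<le> \<mu> \<and>
           (\<forall>l::real. integrable (M x) (\<lambda>y. exp (l * (L y - m))) \<and>
              (\<integral>y. exp (l * (L y - m)) \<partial>M x) \<le> exp (l\<^sup>2 * \<tau>\<^sup>2 / 2))))"

text \<open>
  An analyst is a deterministic strategy. Rounds are numbered from \<open>0\<close>; the arguments of each
  field are the round \<open>i\<close> and the history, i.e. the outcomes of the rounds \<open>j < i\<close> as an
  element of \<open>\<Pi>\<^sub>M j\<in>{..<i}. Y\<close>. The boolean argument of \<open>dataset\<close> selects \<open>x_i^(0)\<close> (\<open>False\<close>)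
  or \<open>x_i^(1)\<close> (\<open>True\<close>). All mechanisms report into one measurable space \<open>Y\<close>, which is
  arbitrary and may for instance be a disjoint sum of several outcome spaces.
\<close>
record ('x, 'y) analyst =
  param :: "nat \<Rightarrow> (nat \<Rightarrow> 'y) \<Rightarrow> real \<times> real"
  mech :: "nat \<Rightarrow> (nat \<Rightarrow> 'y) \<Rightarrow> 'x \<Rightarrow> 'y measure"
  dataset :: "bool \<Rightarrow> nat \<Rightarrow> (nat \<Rightarrow> 'y) \<Rightarrow> 'x"

definition response :: "('x, 'y) analyst \<Rightarrow> bool \<Rightarrow> nat \<Rightarrow> (nat \<Rightarrow> 'y) \<Rightarrow> 'y measure" where
  "response A b i h = mech A i h (dataset A b i h)"

primrec remaining ::
    "(real \<times> real) multiset \<Rightarrow> ('x, 'y) analyst \<Rightarrow> nat \<Rightarrow> (nat \<Rightarrow> 'y) \<Rightarrow> (real \<times> real) multiset" where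
  "remaining E A 0 h = E"
| "remaining E A (Suc i) h = remaining E A i h - {#param A i (restrict h {..<i})#}"

text \<open>
  The last condition only ensures that the two experiments are well defined as probability
  distributions; it is automatic if \<open>Y\<close> is countable and discrete.
\<close>
definition valid_analyst ::
    "('x \<Rightarrow> 'x \<Rightarrow> bool) \<Rightarrow> 'y measure \<Rightarrow> (real \<times> real) multiset \<Rightarrow> ('x, 'y) analyst \<Rightarrow> bool" where
  "valid_analyst nbr Y E A \<longleftrightarrow>
     (\<forall>i < size E.
        (\<forall>h \<in> space (\<Pi>\<^sub>M j\<in>{..<i}. Y).
           param A i h \<in># remaining E A i h \<and>
           CDP nbr Y (fst (param A i h)) (snd (param A i h)) (mech A i h) \<and>
           nbr (dataset A False i h) (dataset A True i h)) \<and>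
        (\<forall>b. response A b i \<in> (\<Pi>\<^sub>M j\<in>{..<i}. Y) \<rightarrow>\<^sub>M prob_algebra Y))"

text \<open>The joint distribution of the outcomes of the first \<open>i\<close> rounds of experiment \<open>b\<close>.\<close>
primrec outcomes ::
    "'y measure \<Rightarrow> ('x, 'y) analyst \<Rightarrow> bool \<Rightarrow> nat \<Rightarrow> (nat \<Rightarrow> 'y) measure" where
  "outcomes Y A b 0 = return (\<Pi>\<^sub>M j\<in>{..<0}. Y) (\<lambda>_. undefined)"
| "outcomes Y A b (Suc i) =
     outcomes Y A b i \<bind> (\<lambda>h. distr (response A b i h) (\<Pi>\<^sub>M j\<in>{..<Suc i}. Y) (\<lambda>y. h(i := y)))"

text \<open>Each round removes one parameter pair, so \<open>E\<close> is exhausted after \<open>size E\<close> rounds.\<close>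
definition view ::
    "'y measure \<Rightarrow> (real \<times> real) multiset \<Rightarrow> ('x, 'y) analyst \<Rightarrow> bool \<Rightarrow> (nat \<Rightarrow> 'y) measure" where
  "view Y E A b = outcomes Y A b (size E)"

definition setwise_DP ::
    "('x \<Rightarrow> 'x \<Rightarrow> bool) \<Rightarrow> 'y measure \<Rightarrow> (real \<times> real) multiset \<Rightarrow> real \<Rightarrow> real \<Rightarrow> bool" where
  "setwise_DP nbr Y E \<epsilon> \<delta> \<longleftrightarrow>
     (\<forall>A::('x, 'y) analyst. valid_analyst nbr Y E A \<longrightarrow>
        (\<forall>b. \<forall>S \<in> sets (\<Pi>\<^sub>M j\<in>{..<size E}. Y).
           measure (view Y E A b) S \<le> exp \<epsilon> * measure (view Y E A (\<not> b)) S + \<delta>))"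

end

theory Submission imports Defs begin

text \<open>
  For \<open>l > 0\<close>, the moment bound of CDP says that the Renyi divergence of order \<open>1 + l\<close> between
  the two outputs is at most \<open>\<mu> + l * \<tau>\<^sup>2 / 2\<close>. By Hoelder's inequality its dual form is
  \<open>(\<integral>F \<partial>P) powr p \<le> exp (\<mu> + l * \<tau>\<^sup>2 / 2) * \<integral>(F powr p) \<partial>Q\<close> with \<open>p = (1 + l) / l\<close>. In this form
  the bound composes adaptively round by round, without densities of the joint distributions (the
  outcome space need not be countably generated), and since every history uses up exactly \<open>E\<close>, the
  costs add up to \<open>\<Sum>\<mu> + l * \<Sum>\<tau>\<^sup>2 / 2\<close>. For \<open>F\<close> the indicator of an event this yields
  \<open>\<epsilon> = \<Sum>\<mu> + l * \<Sum>\<tau>\<^sup>2 / 2 + ln (1 / \<delta>) / l\<close>, and it remains to optimise over \<open>l\<close>.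
\<close>

section \<open>Hoelder's inequality and functions with values in the unit interval\<close>

lemma Holder_integral:
  fixes f g :: "'a \<Rightarrow> real" and p q :: real
  assumes pq: "p > 1" "q > 1" "1 / p + 1 / q = 1"
    and [measurable]: "f \<in> borel_measurable M" "g \<in> borel_measurable M"
    and nonneg: "\<And>x. x \<in> space M \<Longrightarrow> 0 \<le> f x" "\<And>x. x \<in> space M \<Longrightarrow> 0 \<le> g x"
    and intf: "integrable M (\<lambda>x. f x powr p)" and intg: "integrable M (\<lambda>x. g x powr q)"
  shows "(\<integral>x. f x * g x \<partial>M) \<le> (\<integral>x. f x powr p \<partial>M) powr (1 / p) * (\<integral>x. g x powr q \<partial>M) powr (1 / q)"
proof -
  define A where "A = (\<integral>x. f x powr p \<partial>M)"
  define B where "B = (\<integral>x. g x powr q \<partial>M)"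
  have AB: "0 \<le> A" "0 \<le> B"
    unfolding A_def B_def by auto
  show ?thesis
  proof (cases "A = 0 \<or> B = 0")
    case True
    \<comment> \<open>If one of the norms is zero, normalising is impossible, but then that factor
      vanishes almost everywhere.\<close>
    have "AE x in M. f x * g x = 0"
      using True
    proof
      assume "A = 0"
      then have "AE x in M. f x powr p = 0"
        unfolding A_def by (subst (asm) integral_nonneg_eq_0_iff_AE[OF intf]) auto
      then show ?thesis by eventually_elim auto
    next
      assume "B = 0"
      then have "AE x in M. g x powr q = 0"
        unfolding B_def by (subst (asm) integral_nonneg_eq_0_iff_AE[OF intg]) auto
      then show ?thesis by eventually_elim auto
    qed
    then have "(\<integral>x. f x * g x \<partial>M) = 0"
      by (rule integral_eq_zero_AE)
    then show ?thesis by simp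
  next
    case False
    with AB have pos: "0 < A" "0 < B" by auto
    \<comment> \<open>Dividing \<open>f\<close> and \<open>g\<close> by their norms \<open>a\<close>
      and \<open>b\<close> makes the right-hand side of Young's inequality integrate to
      \<open>1 / p + 1 / q = 1\<close>.\<close>
    define a where "a = A powr (1 / p)"
    define b where "b = B powr (1 / q)"
    have ab: "a > 0" "b > 0" "a powr p = A" "b powr q = B"
      using pos pq by (auto simp: a_def b_def powr_powr)
    have young: "f x * g x \<le> a * b * (f x powr p / A / p + g x powr q / B / q)" if "x \<in> space M" for x
    proof -
      have "f x / a * (g x / b) \<le> (f x / a) powr p / p + (g x / b) powr q / q"
        using pq ab nonneg that by (intro Youngs_inequality) auto
      also have "(f x / a) powr p = f x powr p / A"
        using ab nonneg that by (simp add: powr_divide)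
      also have "(g x / b) powr q = g x powr q / B"
        using ab nonneg that by (simp add: powr_divide)
      finally show ?thesis
        using ab by (simp add: field_simps)
    qed
    have "(\<integral>x. f x * g x \<partial>M) \<le> (\<integral>x. a * b * (f x powr p / A / p + g x powr q / B / q) \<partial>M)"
    proof (rule integral_mono'[OF _ young])
      show "integrable M (\<lambda>x. a * b * (f x powr p / A / p + g x powr q / B / q))"
        using intf intg by (intro integrable_mult_right Bochner_Integration.integrable_add integrable_divide)
      show "0 \<le> a * b * (f x powr p / A / p + g x powr q / B / q)" if "x \<in> space M" for x
        using ab pos pq by (intro mult_nonneg_nonneg add_nonneg_nonneg divide_nonneg_nonneg) auto
    qed
    also have "\<dots> = a * b * (A / A / p + B / B / q)"
      using intf intg unfolding A_def B_def by simp
    also have "\<dots> = a * b"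
      using pos pq by simp
    finally show ?thesis
      unfolding a_def b_def A_def B_def .
  qed
qed

lemma (in prob_space) integrable_unit_interval:
  assumes "f \<in> borel_measurable M" "\<And>x. x \<in> space M \<Longrightarrow> f x \<in> {0..1::real}"
  shows "integrable M f"
  using assms by (intro integrable_const_bound[of _ 1]) auto

lemma (in prob_space) integral_unit_interval:
  assumes "f \<in> borel_measurable M" "\<And>x. x \<in> space M \<Longrightarrow> f x \<in> {0..1::real}"
  shows "(\<integral>x. f x \<partial>M) \<in> {0..1}"
proof -
  have f: "integrable M f"
    using assms by (rule integrable_unit_interval)
  have "AE x in M. 0 \<le> f x" "AE x in M. f x \<le> 1"
    using assms(2) by (auto intro: AE_I2)
  then show ?thesis
    using integral_ge_const[OF f] integral_le_const[OF f] by simp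
qed

text \<open>With \<open>g\<close> the density of \<open>P\<close> with respect to \<open>Q\<close>,
  the integral of \<open>F\<close> under \<open>P\<close> is that of \<open>F * g\<close> under
  \<open>Q\<close>. Hoelder's inequality with the conjugate exponents \<open>p\<close> and
  \<open>1 + l\<close> separates the factors, and the integral of \<open>g powr (1 + l)\<close>
  under \<open>Q\<close> is that of \<open>g powr l\<close> under \<open>P\<close>, an exponential
  moment of the privacy loss.\<close>

lemma CDP_integral_powr_le:
  fixes F :: "'y \<Rightarrow> real"
  assumes cdp: "CDP nbr Y \<mu> \<tau> M" and nbr: "nbr x x'" and l: "0 < l"
    and [measurable]: "F \<in> borel_measurable Y"
    and F01: "\<And>y. y \<in> space Y \<Longrightarrow> F y \<in> {0..1}"
  shows "(\<integral>y. F y \<partial>M x) powr ((1 + l) / l)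
           \<le> exp (\<mu> + l * \<tau>\<^sup>2 / 2) * (\<integral>y. F y powr ((1 + l) / l) \<partial>M x')"
proof -
  define P where "P = M x"
  define Q where "Q = M x'"
  define L where "L = privacy_loss P Q"
  define m where "m = (\<integral>y. L y \<partial>P)"
  define g where "g = (\<lambda>y. enn2real (RN_deriv Q P y))"
  define p where "p = (1 + l) / l"
  have PQ: "P \<in> space (prob_algebra Y)" "Q \<in> space (prob_algebra Y)"
    using cdp by (auto simp: CDP_def P_def Q_def)
  then interpret P: prob_space P + Q: prob_space Q
    by (auto simp: space_prob_algebra)
  have sets [measurable_cong]: "sets P = sets Y" "sets Q = sets Y"
    using PQ by (auto simp: space_prob_algebra)
  have space: "space P = space Y" "space Q = space Y"
    using sets by (auto dest: sets_eq_imp_space_eq)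
  have ac: "absolutely_continuous Q P" and m: "m \<le> \<mu>"
    and int: "integrable P (\<lambda>y. exp (l * (L y - m)))"
    and mgf: "(\<integral>y. exp (l * (L y - m)) \<partial>P) \<le> exp (l\<^sup>2 * \<tau>\<^sup>2 / 2)"
    using cdp nbr by (auto simp: CDP_def Let_def same_support_def P_def Q_def L_def m_def)
  have [measurable]: "g \<in> borel_measurable Y"
    unfolding g_def by (subst measurable_cong_sets[OF sets(2)[symmetric] refl]) measurable
  have RN: "integrable P f \<longleftrightarrow> integrable Q (\<lambda>y. g y * f y)"
      "(\<integral>y. f y \<partial>P) = (\<integral>y. g y * f y \<partial>Q)" if "f \<in> borel_measurable Q" for f
    using Q.RN_deriv_integrable[OF P.sigma_finite_measure_axioms ac _ that]
      Q.RN_deriv_integral[OF P.sigma_finite_measure_axioms ac _ that] sets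
    by (auto simp: g_def)
  \<comment> \<open>Where the derivative is zero or infinite, \<open>g y = 0\<close> and
    \<open>exp (l * ln (g y))\<close> differs from \<open>g y powr l\<close>. Such points form a
    \<open>P\<close>-null set.\<close>
  have g_pos: "AE y in P. 0 < g y"
  proof -
    obtain D where "AE y in Q. RN_deriv Q P y = ennreal (D y)" "AE y in P. 0 < D y"
      using Q.real_RN_deriv[OF P.finite_measure_axioms ac] sets by metis
    moreover from this(1) have "AE y in P. RN_deriv Q P y = ennreal (D y)"
      using absolutely_continuous_AE[OF _ ac] sets by simp
    ultimately show ?thesis
      by (auto simp: g_def elim!: eventually_elim2)
  qed
  \<comment> \<open>The factor \<open>exp (l * m)\<close> undoes the centring of the moment bound.
    The bound \<open>m \<le> \<mu>\<close> enters later, where \<open>0 < l\<close> keeps its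
    direction.\<close>
  have exp_eq: "AE y in P. exp (l * m) * exp (l * (L y - m)) = g y powr l"
    using g_pos by eventually_elim
      (auto simp: L_def privacy_loss_def powr_def algebra_simps g_def simp flip: exp_add)
  have "integrable P (\<lambda>y. exp (l * m) * exp (l * (L y - m)))"
    using int by simp
  then have intgP: "integrable P (\<lambda>y. g y powr l)"
    by (rule Bochner_Integration.integrable_cong_AE_imp) (use exp_eq in auto)
  have "(\<integral>y. g y powr l \<partial>P) = (\<integral>y. exp (l * m) * exp (l * (L y - m)) \<partial>P)"
    using exp_eq int by (intro integral_cong_AE) auto
  also have "\<dots> \<le> exp (l * m) * exp (l\<^sup>2 * \<tau>\<^sup>2 / 2)"
    using mgf by simp
  also have "\<dots> \<le> exp (l * (\<mu> + l * \<tau>\<^sup>2 / 2))"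
    using m l by (simp add: algebra_simps power2_eq_square flip: exp_add)
  finally have renyi_P: "(\<integral>y. g y powr l \<partial>P) \<le> exp (l * (\<mu> + l * \<tau>\<^sup>2 / 2))" .
  have powr_Suc: "g y * g y powr l = g y powr (1 + l)" for y
    using l by (cases "g y = 0") (auto simp: powr_add g_def)
  have intg: "integrable Q (\<lambda>y. g y powr (1 + l))"
    using RN(1)[of "\<lambda>y. g y powr l"] intgP by (simp add: powr_Suc)
  have renyi: "(\<integral>y. g y powr (1 + l) \<partial>Q) \<le> exp (l * (\<mu> + l * \<tau>\<^sup>2 / 2))"
    using RN(2)[of "\<lambda>y. g y powr l"] renyi_P by (simp add: powr_Suc)
  have p: "p > 1" "1 / p + 1 / (1 + l) = 1"
    using l by (auto simp: p_def divide_simps)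
  have Fp01: "F y powr p \<in> {0..1}" if "y \<in> space Y" for y
    using F01[OF that] p by (auto intro: powr_le1)
  have "(\<integral>y. F y \<partial>P) = (\<integral>y. F y * g y \<partial>Q)"
    using RN(2)[of F] by (simp add: mult.commute)
  also have "\<dots> \<le> (\<integral>y. F y powr p \<partial>Q) powr (1 / p) * (\<integral>y. g y powr (1 + l) \<partial>Q) powr (1 / (1 + l))"
  proof (rule Holder_integral)
    show "integrable Q (\<lambda>y. F y powr p)"
      using Fp01 by (intro Q.integrable_unit_interval) (simp_all add: space)
    show "0 \<le> F y" if "y \<in> space Q" for y
      using F01 that by (simp add: space)
  qed (use p l intg in \<open>simp_all add: g_def\<close>)
  finally have holder: "(\<integral>y. F y \<partial>P)
      \<le> (\<integral>y. F y powr p \<partial>Q) powr (1 / p) * (\<integral>y. g y powr (1 + l) \<partial>Q) powr (1 / (1 + l))" .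
  have "0 \<le> (\<integral>y. F y \<partial>P)"
    using F01 by (intro Bochner_Integration.integral_nonneg) (simp add: space)
  with holder have "(\<integral>y. F y \<partial>P) powr p
      \<le> ((\<integral>y. F y powr p \<partial>Q) powr (1 / p) * (\<integral>y. g y powr (1 + l) \<partial>Q) powr (1 / (1 + l))) powr p"
    using p by (intro powr_mono2) simp_all
  \<comment> \<open>The exponent \<open>1 / l\<close> on the moment is what removes the factor
    \<open>l\<close> from the exponent of its bound.\<close>
  also have "\<dots> = (\<integral>y. F y powr p \<partial>Q) * (\<integral>y. g y powr (1 + l) \<partial>Q) powr (1 / l)"
  proof -
    have "p / (1 + l) = 1 / l"
      using l by (simp add: p_def)
    then show ?thesis
      using p by (simp add: powr_mult powr_powr)
  qed
  also have "\<dots> \<le> (\<integral>y. F y powr p \<partial>Q) * exp (l * (\<mu> + l * \<tau>\<^sup>2 / 2)) powr (1 / l)"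
    using renyi l by (intro mult_left_mono powr_mono2) auto
  also have "\<dots> = exp (\<mu> + l * \<tau>\<^sup>2 / 2) * (\<integral>y. F y powr p \<partial>Q)"
    using l by (simp add: powr_def)
  finally show ?thesis
    unfolding P_def Q_def p_def .
qed

section \<open>From a power bound to an additive error\<close>

text \<open>If \<open>P \<le> \<delta>\<close>, the additive term suffices. Otherwise
  \<open>P powr (1 / l)\<close> is at least \<open>\<delta> powr (1 / l)\<close>, and dividing by
  the latter adds \<open>ln (1 / \<delta>) / l\<close> to the exponent.\<close>

lemma powr_bound_imp_DP_bound:
  fixes P Q c l \<delta> :: real
  assumes l: "0 < l" and \<delta>: "0 < \<delta>" and P: "0 \<le> P" and Q: "0 \<le> Q"
    and le: "P powr ((1 + l) / l) \<le> exp c * Q"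
  shows "P \<le> exp (c + ln (1 / \<delta>) / l) * Q + \<delta>"
proof (cases "P \<le> \<delta>")
  case True
  then show ?thesis using Q by (simp add: add_increasing)
next
  case False
  then have pos: "0 < P" using \<delta> by simp
  have e: "(1 + l) / l = 1 + 1 / l"
    using l by (simp add: field_simps)
  have "\<delta> powr (1 / l) * P \<le> P powr (1 / l) * P"
    using False \<delta> l P by (intro mult_right_mono powr_mono2) auto
  also have "\<dots> = P powr ((1 + l) / l)"
    using pos by (simp add: powr_add e)
  also note le
  finally have "P \<le> exp c * Q / \<delta> powr (1 / l)"
    using \<delta> by (simp add: field_simps)
  also have "\<dots> = exp (c + ln (1 / \<delta>) / l) * Q"
    using \<delta> by (simp add: powr_def ln_div exp_add exp_diff field_simps exp_minus)
  finally show ?thesis using \<delta> by simp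
qed

section \<open>Parameter bookkeeping and the distribution of the outcomes\<close>

lemma remaining_cong:
  assumes "\<And>j. j < i \<Longrightarrow> h j = h' j"
  shows "remaining E A i h = remaining E A i h'"
  using assms
proof (induction i)
  case (Suc i)
  have "restrict h {..<i} = restrict h' {..<i}"
    using Suc.prems by (intro restrict_ext) simp
  then show ?case
    using Suc by simp
qed simp

text \<open>Multiset difference silently ignores an absent element; validity puts the chosen pair
  among the remaining ones, so every round really removes one. Hence nothing is left at the
  end.\<close>

lemma size_remaining:
  assumes A: "valid_analyst nbr Y E A" and i: "i \<le> size E" and h: "h \<in> space (\<Pi>\<^sub>M j\<in>{..<i}. Y)"
  shows "size (remaining E A i h) = size E - i"
  using i h
proof (induction i arbitrary: h)
  case (Suc i)
  define h' where "h' = restrict h {..<i}"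
  have h': "h' \<in> space (\<Pi>\<^sub>M j\<in>{..<i}. Y)"
    using Suc.prems by (auto simp: h'_def space_PiM PiE_def Pi_def)
  have eq: "remaining E A i h = remaining E A i h'"
    by (rule remaining_cong) (simp add: h'_def)
  have "param A i h' \<in># remaining E A i h'"
    using A Suc.prems h' by (auto simp: valid_analyst_def)
  then show ?case
    using Suc.IH[OF _ h'] Suc.prems by (simp add: eq size_Diff_singleton flip: h'_def)
qed simp

text \<open>Validity relates the two datasets in one order only; symmetry supplies the other, so
  that both directions of the privacy bound can be treated at once.\<close>

lemma CDP_neighbor_response:
  assumes "symp nbr" "valid_analyst nbr Y E A" "i < size E" "h \<in> space (\<Pi>\<^sub>M j\<in>{..<i}. Y)"
  shows "nbr (dataset A b i h) (dataset A (\<not> b) i h)"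
  using assms by (cases b) (auto simp: valid_analyst_def dest: sympD)

lemma round_measurable:
  assumes "response A b i \<in> (\<Pi>\<^sub>M j\<in>{..<i}. Y) \<rightarrow>\<^sub>M prob_algebra Y"
  shows "(\<lambda>h. distr (response A b i h) (\<Pi>\<^sub>M j\<in>{..<Suc i}. Y) (\<lambda>y. h(i := y)))
    \<in> (\<Pi>\<^sub>M j\<in>{..<i}. Y) \<rightarrow>\<^sub>M prob_algebra (\<Pi>\<^sub>M j\<in>{..<Suc i}. Y)"
proof (rule measurable_distr_prob_space2[OF assms])
  show "(\<lambda>(h, y). h(i := y)) \<in> (\<Pi>\<^sub>M j\<in>{..<i}. Y) \<Otimes>\<^sub>M Y \<rightarrow>\<^sub>M (\<Pi>\<^sub>M j\<in>{..<Suc i}. Y)"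
    using measurable_add_dim[of i "{..<i}" "\<lambda>_. Y"] by (simp add: lessThan_Suc)
qed

lemma outcomes_prob_algebra:
  assumes "valid_analyst nbr Y E A" "i \<le> size E"
  shows "outcomes Y A b i \<in> space (prob_algebra (\<Pi>\<^sub>M j\<in>{..<i}. Y))"
  using assms(2)
proof (induction i)
  case 0
  show ?case
    by (auto simp: space_prob_algebra space_PiM intro!: prob_space_return)
next
  case (Suc i)
  then have "response A b i \<in> (\<Pi>\<^sub>M j\<in>{..<i}. Y) \<rightarrow>\<^sub>M prob_algebra Y"
    using assms(1) by (simp add: valid_analyst_def)
  note K = round_measurable[OF this]
  show ?case
    using Suc prob_space_bind'[OF _ K] sets_bind'[OF _ K] by (simp add: space_prob_algebra)
qed

text \<open>The tower property. Measurability and range of \<open>G\<close> are included so that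
  \<open>G\<close> can serve as the test function of the preceding round.\<close>

lemma integral_outcomes_Suc:
  fixes f :: "(nat \<Rightarrow> 'y) \<Rightarrow> real" and b :: bool
  assumes A: "valid_analyst nbr Y E A" and i: "i < size E"
    and f [measurable]: "f \<in> borel_measurable (\<Pi>\<^sub>M j\<in>{..<Suc i}. Y)"
    and f01: "\<And>h. h \<in> space (\<Pi>\<^sub>M j\<in>{..<Suc i}. Y) \<Longrightarrow> f h \<in> {0..1}"
  defines "G \<equiv> \<lambda>h. \<integral>y. f (h(i := y)) \<partial>response A b i h"
  shows "(\<integral>h. f h \<partial>outcomes Y A b (Suc i)) = (\<integral>h. G h \<partial>outcomes Y A b i)"
    and "G \<in> borel_measurable (\<Pi>\<^sub>M j\<in>{..<i}. Y)"
    and "\<And>h. h \<in> space (\<Pi>\<^sub>M j\<in>{..<i}. Y) \<Longrightarrow> G h \<in> {0..1}"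
proof -
  let ?X = "\<lambda>n. \<Pi>\<^sub>M j\<in>{..<n}. Y"
  let ?K = "\<lambda>h. distr (response A b i h) (?X (Suc i)) (\<lambda>y. h(i := y))"
  have R: "response A b i \<in> ?X i \<rightarrow>\<^sub>M prob_algebra Y"
    using A i by (simp add: valid_analyst_def)
  have K: "?K \<in> ?X i \<rightarrow>\<^sub>M prob_algebra (?X (Suc i))"
    using R by (rule round_measurable)
  have P: "outcomes Y A b i \<in> space (prob_algebra (?X i))"
    using A i by (intro outcomes_prob_algebra) auto
  then interpret P: prob_space "outcomes Y A b i"
    by (simp add: space_prob_algebra)
  have sets [measurable_cong]: "sets (outcomes Y A b i) = sets (?X i)"
    using P by (simp add: space_prob_algebra)
  have space: "space (outcomes Y A b i) = space (?X i)"
    using sets by (rule sets_eq_imp_space_eq)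
  have prob_K: "prob_space (?K h)" if "h \<in> space (?X i)" for h
    using measurable_space[OF K that] by (simp add: space_prob_algebra)
  have upd: "(\<lambda>y. h(i := y)) \<in> response A b i h \<rightarrow>\<^sub>M ?X (Suc i)" if "h \<in> space (?X i)" for h
  proof -
    have "sets (response A b i h) = sets Y"
      using measurable_space[OF R that] by (simp add: space_prob_algebra)
    then show ?thesis
      using that by (subst measurable_cong_sets[OF _ refl])
        (auto intro!: measurable_fun_upd[where J = "{..<i}"] simp: lessThan_Suc)
  qed
  have G: "G h = (\<integral>h'. f h' \<partial>?K h)" if "h \<in> space (?X i)" for h
    unfolding G_def using upd[OF that] by (simp add: integral_distr)
  have "(\<integral>h. f h \<partial>outcomes Y A b (Suc i)) = (\<integral>h. (\<integral>h'. f h' \<partial>?K h) \<partial>outcomes Y A b i)"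
    unfolding outcomes.simps
  \<comment> \<open>\<open>B\<close> bounds the absolute value of \<open>f\<close>, and
    \<open>B'\<close> the total mass of the kernel.\<close>
  proof (rule integral_bind[where B = 1 and B' = 1 and K = "?X (Suc i)"])
    show "?K \<in> outcomes Y A b i \<rightarrow>\<^sub>M subprob_algebra (?X (Suc i))"
      using measurable_prob_algebraD[OF K] by measurable
    show "AE h in outcomes Y A b i. emeasure (?K h) (space (?K h)) \<le> ennreal 1"
      by (intro AE_I2) (simp only: space prob_space.emeasure_space_1[OF prob_K] ennreal_1)
  qed (use f01 P.finite_measure_axioms in auto)
  also have "\<dots> = (\<integral>h. G h \<partial>outcomes Y A b i)"
    by (intro Bochner_Integration.integral_cong) (auto simp: G space)
  finally show "(\<integral>h. f h \<partial>outcomes Y A b (Suc i)) = (\<integral>h. G h \<partial>outcomes Y A b i)" .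
  have "(\<lambda>h. \<integral>h'. f h' \<partial>?K h) \<in> borel_measurable (?X i)"
    using measurable_compose[OF measurable_prob_algebraD[OF K] integral_measurable_subprob_algebra[OF f]] .
  then show "G \<in> borel_measurable (?X i)"
    by (subst measurable_cong[OF G])
  show "G h \<in> {0..1}" if "h \<in> space (?X i)" for h
    unfolding G[OF that] using f01
    by (intro prob_space.integral_unit_interval[OF prob_K[OF that]]) auto
qed

section \<open>Adaptive composition of the moment bounds\<close>

definition renyi_cost :: "real \<Rightarrow> (real \<times> real) multiset \<Rightarrow> real" where
  "renyi_cost l E = (\<Sum>(m, t)\<in>#E. m + l * t\<^sup>2 / 2)"

text \<open>The pair of round \<open>i\<close> is chosen from \<open>h\<close> alone, before
  \<open>y\<close> is seen, and it is an element of the remaining multiset, so its removal lowers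
  the cost by exactly its own summand.\<close>

lemma renyi_cost_remaining_Suc:
  assumes "valid_analyst nbr Y E A" "i < size E" "h \<in> space (\<Pi>\<^sub>M j\<in>{..<i}. Y)"
  shows "renyi_cost l (remaining E A i h)
    = fst (param A i h) + l * (snd (param A i h))\<^sup>2 / 2 + renyi_cost l (remaining E A (Suc i) (h(i := y)))"
proof -
  have "restrict (h(i := y)) {..<i} = h"
    using assms(3) by (auto simp: space_PiM PiE_def extensional_def fun_eq_iff)
  moreover have "remaining E A i (h(i := y)) = remaining E A i h"
    by (rule remaining_cong) simp
  ultimately have "remaining E A i h = add_mset (param A i h) (remaining E A (Suc i) (h(i := y)))"
    using assms by (simp add: valid_analyst_def)
  then show ?thesis
    by (simp add: renyi_cost_def case_prod_beta)
qed

text \<open>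
  Nothing makes \<open>param\<close>, hence \<open>remaining\<close>, measurable in the history. Comparing \<open>F\<close> with a
  separate \<open>H\<close> instead of integrating \<open>exp (renyi_cost \<dots>) * F powr p\<close> keeps the cost
  outside all integrals: the cost remaining after round \<open>i\<close> does not depend on its outcome.
\<close>
lemma outcomes_integral_powr_le:
  fixes F H :: "(nat \<Rightarrow> 'y) \<Rightarrow> real"
  assumes symp: "symp nbr" and A: "valid_analyst nbr Y E A" and l: "0 < l" and i: "i \<le> size E"
    and F: "F \<in> borel_measurable (\<Pi>\<^sub>M j\<in>{..<i}. Y)"
      "\<And>h. h \<in> space (\<Pi>\<^sub>M j\<in>{..<i}. Y) \<Longrightarrow> F h \<in> {0..1}"
    and H: "H \<in> borel_measurable (\<Pi>\<^sub>M j\<in>{..<i}. Y)"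
      "\<And>h. h \<in> space (\<Pi>\<^sub>M j\<in>{..<i}. Y) \<Longrightarrow> H h \<in> {0..1}"
    and le: "\<And>h. h \<in> space (\<Pi>\<^sub>M j\<in>{..<i}. Y) \<Longrightarrow>
      F h powr ((1 + l) / l) \<le> exp (renyi_cost l (remaining E A i h)) * H h"
  shows "(\<integral>h. F h \<partial>outcomes Y A b i) powr ((1 + l) / l)
    \<le> exp (renyi_cost l E) * (\<integral>h. H h \<partial>outcomes Y A (\<not> b) i)"
  using i F H le
proof (induction i arbitrary: F H)
  case 0
  then show ?case
    by (simp add: integral_return space_PiM)
next
  case (Suc i)
  let ?X = "\<lambda>n. \<Pi>\<^sub>M j\<in>{..<n}. Y"
  let ?p = "(1 + l) / l"
  let ?F = "\<lambda>h. \<integral>y. F (h(i := y)) \<partial>response A b i h"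
  let ?H = "\<lambda>h. \<integral>y. H (h(i := y)) \<partial>response A (\<not> b) i h"
  have i: "i < size E" using Suc.prems by simp
  have F: "(\<integral>h. F h \<partial>outcomes Y A b (Suc i)) = (\<integral>h. ?F h \<partial>outcomes Y A b i)"
    "?F \<in> borel_measurable (?X i)" "\<And>h. h \<in> space (?X i) \<Longrightarrow> ?F h \<in> {0..1}"
    by (rule integral_outcomes_Suc[OF A i]; use Suc.prems(2,3) in blast)+
  have H: "(\<integral>h. H h \<partial>outcomes Y A (\<not> b) (Suc i)) = (\<integral>h. ?H h \<partial>outcomes Y A (\<not> b) i)"
    "?H \<in> borel_measurable (?X i)" "\<And>h. h \<in> space (?X i) \<Longrightarrow> ?H h \<in> {0..1}"
    by (rule integral_outcomes_Suc[OF A i]; use Suc.prems(4,5) in blast)+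
  \<comment> \<open>The averaged functions satisfy the hypothesis one round earlier: round
    \<open>i\<close> contributes \<open>exp ?c\<close>, the hypothesis after that round
    \<open>exp (?r - ?c)\<close>, and the product is \<open>exp ?r\<close>.\<close>
  have step: "?F h powr ?p \<le> exp (renyi_cost l (remaining E A i h)) * ?H h" if h: "h \<in> space (?X i)" for h
  proof -
    let ?c = "fst (param A i h) + l * (snd (param A i h))\<^sup>2 / 2"
    let ?r = "renyi_cost l (remaining E A i h)"
    let ?Q = "response A (\<not> b) i h"
    have "response A (\<not> b) i \<in> ?X i \<rightarrow>\<^sub>M prob_algebra Y"
      using A i by (simp add: valid_analyst_def)
    then have R: "?Q \<in> space (prob_algebra Y)"
      using h by (rule measurable_space)
    then interpret Q: prob_space ?Q by (simp add: space_prob_algebra)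
    have sets [measurable_cong]: "sets ?Q = sets Y"
      using R by (simp add: space_prob_algebra)
    have space: "space ?Q = space Y"
      using sets by (rule sets_eq_imp_space_eq)
    have upd [measurable]: "(\<lambda>y. h(i := y)) \<in> Y \<rightarrow>\<^sub>M ?X (Suc i)"
      using h by (auto intro!: measurable_fun_upd[where J = "{..<i}"] simp: lessThan_Suc)
    note [measurable] = Suc.prems(2,4)
    have F01: "F (h(i := y)) \<in> {0..1}" and H01: "H (h(i := y)) \<in> {0..1}" if "y \<in> space Y" for y
      using Suc.prems(3,5) measurable_space[OF upd that] by auto
    \<comment> \<open>For a fixed history both experiments run the same mechanism, on neighbouring
      datasets.\<close>
    have "?F h powr ?p \<le> exp ?c * (\<integral>y. F (h(i := y)) powr ?p \<partial>?Q)"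
      unfolding response_def
      by (rule CDP_integral_powr_le[where nbr = nbr and Y = Y])
        (use A i h l F01 CDP_neighbor_response[OF symp A i h] in \<open>auto simp: valid_analyst_def\<close>)
    also have "\<dots> \<le> exp ?c * (\<integral>y. exp (?r - ?c) * H (h(i := y)) \<partial>?Q)"
    proof (intro mult_left_mono integral_mono)
      show "integrable ?Q (\<lambda>y. F (h(i := y)) powr ?p)"
        using F01 l by (intro Q.integrable_unit_interval) (auto simp: space intro: powr_le1)
      show "integrable ?Q (\<lambda>y. exp (?r - ?c) * H (h(i := y)))"
        using H01 by (intro integrable_mult_right Q.integrable_unit_interval) (auto simp: space)
      show "F (h(i := y)) powr ?p \<le> exp (?r - ?c) * H (h(i := y))" if "y \<in> space ?Q" for y
      proof -
        have "renyi_cost l (remaining E A (Suc i) (h(i := y))) = ?r - ?c"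
          using renyi_cost_remaining_Suc[OF A i h, of l y] by linarith
        then show ?thesis
          using Suc.prems(6)[OF measurable_space[OF upd], of y] that by (simp only: space)
      qed
    qed simp
    also have "\<dots> = exp ?r * ?H h"
      by (simp add: exp_diff)
    finally show ?thesis .
  qed
  show ?case
    unfolding F(1) H(1) using i by (intro Suc.IH[OF _ F(2,3) H(2,3) step]) auto
qed

text \<open>The composition bound is applied with the indicator of \<open>S\<close> as both test
  functions. An indicator equals its own power and the cost of the exhausted multiset is zero, so
  the pointwise hypothesis holds with equality.\<close>

lemma view_powr_le:
  fixes A :: "('x, 'y) analyst"
  assumes symp: "symp nbr" and A: "valid_analyst nbr Y E A" and l: "0 < l"
    and S [measurable]: "S \<in> sets (\<Pi>\<^sub>M j\<in>{..<size E}. Y)"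
  shows "measure (view Y E A b) S powr ((1 + l) / l)
    \<le> exp (renyi_cost l E) * measure (view Y E A (\<not> b)) S"
proof -
  have "remaining E A (size E) h = {#}" if "h \<in> space (\<Pi>\<^sub>M j\<in>{..<size E}. Y)" for h
    using size_remaining[OF A le_refl that] by simp
  then have "(\<integral>h. indicator S h \<partial>view Y E A b) powr ((1 + l) / l)
    \<le> exp (renyi_cost l E) * (\<integral>h. indicator S h \<partial>view Y E A (\<not> b))"
    unfolding view_def
    by (intro outcomes_integral_powr_le[OF symp A l le_refl])
      (auto simp: renyi_cost_def indicator_def)
  moreover have "S \<in> sets (view Y E A b')" for b'
    using outcomes_prob_algebra[OF A le_refl] S by (simp add: view_def space_prob_algebra)
  ultimately show ?thesis
    by (simp add: sets.Int_space_eq2)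
qed

section \<open>Optimising the order and the final bound\<close>

text \<open>For \<open>T > 0\<close>, the sum \<open>l * T / 2 + d / l\<close> is smallest where its
  two terms agree, at \<open>l = sqrt (2 * d / T)\<close>. For \<open>T = 0\<close> no minimum is
  attained, and the bound follows by letting \<open>l\<close> tend to infinity.\<close>

lemma le_of_forall_order:
  fixes P Q m T d :: real
  assumes le: "\<And>l. 0 < l \<Longrightarrow> P \<le> exp (m + l * T / 2 + d / l) * Q + \<delta>"
    and T: "0 \<le> T" and d: "0 < d"
  shows "P \<le> exp (m + sqrt (2 * T * d)) * Q + \<delta>"
proof (cases "T = 0")
  case True
  have "((\<lambda>l. exp (m + d / l) * Q + \<delta>) \<longlongrightarrow> exp (m + 0) * Q + \<delta>) at_top"
    by (intro tendsto_intros real_tendsto_divide_at_top[OF tendsto_const] filterlim_ident)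
  moreover have "eventually (\<lambda>l. P \<le> exp (m + d / l) * Q + \<delta>) at_top"
    using eventually_gt_at_top[of 0] by eventually_elim (use le True in auto)
  ultimately show ?thesis
    using True by (auto intro: tendsto_lowerbound)
next
  case False
  define l where "l = sqrt (2 * d / T)"
  have l: "0 < l" using False T d by (simp add: l_def)
  have s: "sqrt (2 * T * d) = l * T"
    using T False by (simp add: l_def real_sqrt_mult real_sqrt_divide real_div_sqrt field_simps)
  have "l * l = 2 * d / T"
    using T d by (simp add: l_def)
  then have "d / l = l * T / 2"
    using l False by (simp add: field_simps)
  then have eq: "m + l * T / 2 + d / l = m + sqrt (2 * T * d)"
    using s by linarith
  show ?thesis
    using le[OF l] unfolding eq .
qed

theorem lemma3p3:
  fixes nbr :: "'x \<Rightarrow> 'x \<Rightarrow> bool" and Y :: "'y measure"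
    and k :: nat and \<mu> \<tau> :: "nat \<Rightarrow> real" and \<delta> :: real
  assumes "symp nbr"
    and "k \<ge> 1"
    and "0 < \<delta>" and "\<delta> \<le> 1"
  shows "setwise_DP nbr Y {#(\<mu> i, \<tau> i). i \<in># mset_set {1..k}#}
           ((\<Sum>i=1..k. \<mu> i) + sqrt (2 * (\<Sum>i=1..k. (\<tau> i)\<^sup>2) * ln (1 / \<delta>))) \<delta>"
  unfolding setwise_DP_def
proof (intro allI impI ballI)
  let ?E = "{#(\<mu> i, \<tau> i). i \<in># mset_set {1..k}#}"
  fix A :: "('x, 'y) analyst" and b and S
  assume A: "valid_analyst nbr Y ?E A" and S: "S \<in> sets (\<Pi>\<^sub>M j\<in>{..<size ?E}. Y)"
  let ?m = "\<Sum>i=1..k. \<mu> i" and ?T = "\<Sum>i=1..k. (\<tau> i)\<^sup>2"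
  let ?P = "\<lambda>b. measure (view Y ?E A b) S"
  show "?P b \<le> exp (?m + sqrt (2 * ?T * ln (1 / \<delta>))) * ?P (\<not> b) + \<delta>"
  \<comment> \<open>For \<open>\<delta> = 1\<close> the logarithm is zero and the optimisation over
    \<open>l\<close> does not apply, but the additive term alone dominates any probability.\<close>
  proof (cases "\<delta> = 1")
    case True
    have "prob_space (view Y ?E A b)"
      using outcomes_prob_algebra[OF A le_refl] by (simp add: view_def space_prob_algebra)
    then show ?thesis
      using True by (simp add: add_increasing prob_space.prob_le_1)
  next
    case False
    then have d: "0 < ln (1 / \<delta>)"
      using assms by simp
    have cost: "renyi_cost l ?E = ?m + l * ?T / 2" for l
    proof -
      have "renyi_cost l ?E = (\<Sum>i=1..k. \<mu> i + l * (\<tau> i)\<^sup>2 / 2)"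
        by (simp add: renyi_cost_def sum_unfold_sum_mset image_mset.compositionality comp_def)
      then show ?thesis
        by (simp only: sum.distrib sum_distrib_left sum_divide_distrib)
    qed
    show ?thesis
    proof (rule le_of_forall_order[OF _ _ d])
      show "?P b \<le> exp (?m + l * ?T / 2 + ln (1 / \<delta>) / l) * ?P (\<not> b) + \<delta>" if "0 < l" for l
        using view_powr_le[OF \<open>symp nbr\<close> A that S, of b] unfolding cost
        by (intro powr_bound_imp_DP_bound that \<open>0 < \<delta>\<close> measure_nonneg)
    qed (simp add: sum_nonneg)
  qed
qed

end
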